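(* Let $u$ be a coherent utility function with weakly compact determining set $\mathcal D$, $A\subseteq L^0$ a $\mathcal D$-consistent convex set containing zero, and $W\in L^1_s(\mathcal D)$. For $F\in L^1_s(\mathcal D)$ let $I_{NBC}(F)$ be the set of $x\in\mathbb R$ such that $$\max_{X\in A,\,h\in\mathbb R}u(W+X+h(F-x))=u(W).$$ Then $$I_{NBC}(F)=\{\mathsf E_{\mathsf Q}F:\mathsf Q\in\mathcal X_{\mathcal D}(W)\cap\mathcal R\},\qquad\mathcal R=\mathcal R(A).$$
   Context: $(\Omega,\mathcal F,\mathsf P)$ is a probability space, $L^0$ is the space of real random variables, and $\mathcal P$ is the set of probability measures absolutely continuous with respect to $\mathsf P$, identified with their densities in $L^1(\mathsf P)$; weak compactness refers to $\sigma(L^1,L^\infty)$. $\mathsf E_{\mathsf Q}X=\mathsf E_{\mathsf Q}X^+-\mathsf E_{\mathsf Q}X^-$ with $\infty-\infty=-\infty$. A coherent utility function is a map $u:L^0\to[-\infty,\infty]$ of the form $u(X)=\inf_{\mathsf Q\in\mathcal D}\mathsf E_{\mathsf Q}X$ with nonempty $\mathcal D\subset\mathcal P$; its determining set is the largest such $\mathcal D$ (it is convex). $L^1_s(\mathcal D)=\{X\in L^0:\lim_{n\to\infty}\sup_{\mathsf Q\in\mathcal D}\mathsf E_{\mathsf Q}|X|I(|X|>n)=0\}$. $\mathcal X_{\mathcal D}(W)=\{\mathsf Q\in\mathcal D:\mathsf E_{\mathsf Q}W=u(W)\in(-\infty,\infty)\}$. $\mathcal R(A)=\{\mathsf Q\in\mathcal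 P:\mathsf E_{\mathsf Q}X\le0\ \forall X\in A\}$; $A$ is $\mathcal D$-consistent if there is $A'\subseteq A\cap L^1_s(\mathcal D)$ with $\mathcal D\cap\mathcal R(A)=\mathcal D\cap\mathcal R(A')$. *)

theory Defs
  imports "HOL-Probability.Probability"
begin

text \<open>
  Throughout, \<open>M\<close> is the reference probability space. Random variables are real measurable
  functions (not equivalence classes) and measures \<open>Q \<lless> M\<close> are kept as measures on the same
  sigma-algebra; they are replaced by their densities only where the topology
  \<open>\<sigma>(L\<^sup>1, L\<^sup>\<infinity>)\<close> is involved.
\<close>

abbreviation L0 :: "'a measure \<Rightarrow> ('a \<Rightarrow> real) set" where
  "L0 M \<equiv> borel_measurable M"

definition ac_probs :: "'a measure \<Rightarrow> 'a measure set" where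
  "ac_probs M = {Q. prob_space Q \<and> sets Q = sets M \<and> absolutely_continuous M Q}"

text \<open>
  The case distinction is needed because \<open>\<infinity> - \<infinity> = \<infinity>\<close> in \<^typ>\<open>ereal\<close>, whereas the convention
  here is \<open>\<infinity> - \<infinity> = -\<infinity>\<close>. The function \<^const>\<open>ennreal\<close> truncates negative numbers to \<open>0\<close>, so the
  two integrals are those of the positive and the negative part of \<open>X\<close>.
\<close>

definition extE :: "'a measure \<Rightarrow> ('a \<Rightarrow> real) \<Rightarrow> ereal" where
  "extE Q X =
    (let p = enn2ereal (\<integral>\<^sup>+ \<omega>. ennreal (X \<omega>) \<partial>Q);
         m = enn2ereal (\<integral>\<^sup>+ \<omega>. ennreal (- X \<omega>) \<partial>Q)
     in if p = \<infinity> \<and> m = \<infinity> then -\<infinity> else p - m)"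

definition Linf :: "'a measure \<Rightarrow> ('a \<Rightarrow> real) set" where
  "Linf M = {g \<in> borel_measurable M. \<exists>C. AE \<omega> in M. \<bar>g \<omega>\<bar> \<le> C}"

text \<open>
  The weak topology \<open>\<sigma>(L\<^sup>1, L\<^sup>\<infinity>)\<close>, on the set of integrable functions. Its open sets are
  saturated under almost everywhere equality, so compactness of a set of functions here is
  compactness of the corresponding set of equivalence classes.
\<close>

definition weak_L1 :: "'a measure \<Rightarrow> ('a \<Rightarrow> real) topology" where
  "weak_L1 M = topology_generated_by
    {{f. integrable M f \<and> (\<integral>\<omega>. f \<omega> * g \<omega> \<partial>M) \<in> U} | g U. g \<in> Linf M \<and> open U}"

definition densities :: "'a measure \<Rightarrow> 'a measure set \<Rightarrow> ('a \<Rightarrow> real) set" where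
  "densities M \<D> =
    {f. integrable M f \<and> (AE \<omega> in M. 0 \<le> f \<omega>) \<and> density M (\<lambda>\<omega>. ennreal (f \<omega>)) \<in> \<D>}"

definition weakly_compact :: "'a measure \<Rightarrow> 'a measure set \<Rightarrow> bool" where
  "weakly_compact M \<D> \<longleftrightarrow> compactin (weak_L1 M) (densities M \<D>)"

definition represents ::
  "'a measure \<Rightarrow> 'a measure set \<Rightarrow> (('a \<Rightarrow> real) \<Rightarrow> ereal) \<Rightarrow> bool" where
  "represents M \<D> u \<longleftrightarrow>
    \<D> \<noteq> {} \<and> \<D> \<subseteq> ac_probs M \<and> (\<forall>X\<in>L0 M. u X = (INF Q\<in>\<D>. extE Q X))"

definition coherent_utility :: "'a measure \<Rightarrow> (('a \<Rightarrow> real) \<Rightarrow> ereal) \<Rightarrow> bool" where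
  "coherent_utility M u \<longleftrightarrow> (\<exists>\<D>. represents M \<D> u)"

definition is_determining_set ::
  "'a measure \<Rightarrow> (('a \<Rightarrow> real) \<Rightarrow> ereal) \<Rightarrow> 'a measure set \<Rightarrow> bool" where
  "is_determining_set M u \<D> \<longleftrightarrow>
    represents M \<D> u \<and> (\<forall>\<D>'. represents M \<D>' u \<longrightarrow> \<D>' \<subseteq> \<D>)"

definition L1s :: "'a measure \<Rightarrow> 'a measure set \<Rightarrow> ('a \<Rightarrow> real) set" where
  "L1s M \<D> = {X \<in> L0 M.
    (\<lambda>n::nat. SUP Q\<in>\<D>. extE Q (\<lambda>\<omega>. \<bar>X \<omega>\<bar> * indicator {\<omega>. \<bar>X \<omega>\<bar> > real n} \<omega>))
      \<longlonglongrightarrow> 0}"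

definition extreme_measures ::
  "(('a \<Rightarrow> real) \<Rightarrow> ereal) \<Rightarrow> 'a measure set \<Rightarrow> ('a \<Rightarrow> real) \<Rightarrow> 'a measure set" where
  "extreme_measures u \<D> W =
    {Q \<in> \<D>. extE Q W = u W \<and> u W \<in> {-\<infinity><..<\<infinity>}}"

definition risk_neutral :: "'a measure \<Rightarrow> ('a \<Rightarrow> real) set \<Rightarrow> 'a measure set" where
  "risk_neutral M A = {Q \<in> ac_probs M. \<forall>X\<in>A. extE Q X \<le> 0}"

definition consistent :: "'a measure \<Rightarrow> 'a measure set \<Rightarrow> ('a \<Rightarrow> real) set \<Rightarrow> bool" where
  "consistent M \<D> A \<longleftrightarrow>
    (\<exists>A'. A' \<subseteq> A \<inter> L1s M \<D> \<and> \<D> \<inter> risk_neutral M A = \<D> \<inter> risk_neutral M A')"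

text \<open>Spelled out because functions do not form an instance of \<^class>\<open>real_vector\<close>.\<close>

definition convex_rvs :: "('a \<Rightarrow> real) set \<Rightarrow> bool" where
  "convex_rvs A \<longleftrightarrow>
    (\<forall>X\<in>A. \<forall>Y\<in>A. \<forall>t. 0 \<le> t \<and> t \<le> 1 \<longrightarrow> (\<lambda>\<omega>. (1 - t) * X \<omega> + t * Y \<omega>) \<in> A)"

definition is_max :: "ereal set \<Rightarrow> ereal \<Rightarrow> bool" where
  "is_max S m \<longleftrightarrow> m \<in> S \<and> (\<forall>s\<in>S. s \<le> m)"

definition I_NBC ::
  "(('a \<Rightarrow> real) \<Rightarrow> ereal) \<Rightarrow> ('a \<Rightarrow> real) set \<Rightarrow> ('a \<Rightarrow> real) \<Rightarrow> ('a \<Rightarrow> real) \<Rightarrow> real set" where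
  "I_NBC u A W F =
    {x. is_max {u (\<lambda>\<omega>. W \<omega> + X \<omega> + h * (F \<omega> - x)) | X h. X \<in> A} (u W)}"

end

theory Submission imports Defs begin

text \<open>
  Let \<open>C\<close> be the convex set of all \<open>W + X + h (F - x)\<close> with \<open>X \<in> A\<close> integrable and weakly
  continuous on \<open>\<D>\<close>, and \<open>h\<close> real. The condition on \<open>x\<close> gives
  \<open>min\<^bsub>Q \<in> \<D>\<^esub> E\<^sub>Q Y \<le> u(W)\<close> for each \<open>Y \<in> C\<close>. Since \<open>\<D>\<close> is convex, being maximal, and weakly
  compact, a minimax theorem yields one \<open>Q\<close> that works for all \<open>Y \<in> C\<close>. Taking \<open>X = 0\<close> gives
  \<open>E\<^sub>Q W = u(W)\<close> (with \<open>h = 0\<close>) and \<open>E\<^sub>Q F = x\<close> (with \<open>h = 1\<close> and \<open>h = -1\<close>); taking \<open>h = 0\<close> gives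
  \<open>E\<^sub>Q X \<le> 0\<close>, which by consistency suffices for \<open>Q \<in> \<R>(A)\<close>. Applying minimax to \<open>C\<close>
  itself rather than separating finitely many expectations avoids having to rescale \<open>X\<close>, as
  \<open>A\<close> need not be a cone.
\<close>

section \<open>Minimax on a compact set with mixtures\<close>

text \<open>Separation in the plane. The image of \<open>S\<close> under the pair of functions is
  compact by continuity and convex by \<open>mix\<close>. If it missed the closed negative quadrant,
  the normal of a strictly separating line would have nonnegative coordinates, and scaling these to
  sum 1 would give weights contradicting \<open>comb\<close>.\<close>

lemma common_nonpos_pair:
  fixes f g :: "'b \<Rightarrow> real"
  assumes S: "compactin T S"
    and f: "continuous_map T euclideanreal f" and g: "continuous_map T euclideanreal g"
    and mix: "\<And>p q t. p \<in> S \<Longrightarrow> q \<in> S \<Longrightarrow> 0 \<le> t \<Longrightarrow> t \<le> 1 \<Longrightarrow>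
      \<exists>r\<in>S. f r = (1 - t) * f p + t * f q \<and> g r = (1 - t) * g p + t * g q"
    and comb: "\<And>t. 0 \<le> t \<Longrightarrow> t \<le> 1 \<Longrightarrow> \<exists>p\<in>S. (1 - t) * f p + t * g p \<le> 0"
  shows "\<exists>p\<in>S. f p \<le> 0 \<and> g p \<le> 0"
proof (rule ccontr)
  assume neg: "\<not> ?thesis"
  define K where "K = (\<lambda>p. (f p, g p)) ` S"
  define N where "N = {..0::real} \<times> {..0::real}"
  have "continuous_map T (euclidean :: (real \<times> real) topology) (\<lambda>p. (f p, g p))"
    using continuous_map_pairedI[OF f g] by (simp add: euclidean_product_topology)
  with S have "compact K"
    unfolding K_def using image_compactin[OF S, of euclidean] by simp
  moreover have "K \<noteq> {}"
    using comb[of 0] by (auto simp: K_def)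
  moreover have "convex K"
    unfolding convex_alt
  proof (intro ballI allI impI)
    fix x y and t :: real assume "x \<in> K" "y \<in> K" and t: "0 \<le> t \<and> t \<le> 1"
    then obtain p q where "p \<in> S" "q \<in> S" and xy: "x = (f p, g p)" "y = (f q, g q)"
      by (auto simp: K_def)
    then obtain r where "r \<in> S" "f r = (1 - t) * f p + t * f q" "g r = (1 - t) * g p + t * g q"
      using mix t by blast
    then show "(1 - t) *\<^sub>R x + t *\<^sub>R y \<in> K"
      unfolding K_def xy by (intro image_eqI[of _ _ r]) auto
  qed
  moreover have "convex N" "closed N"
    unfolding N_def by (auto intro: convex_Times closed_Times)
  moreover have "N \<inter> K = {}"
    using neg by (auto simp: N_def K_def)
  ultimately obtain v b where
    N: "\<And>x. x \<in> N \<Longrightarrow> v \<bullet> x < b" and K: "\<And>x. x \<in> K \<Longrightarrow> v \<bullet> x > b"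
    using separating_hyperplane_closed_compact[of N K] by blast
  obtain a c where v: "v = (a, c)" by (cases v)
  have b: "b > 0"
    using N[of "(0, 0)"] by (simp add: N_def v)
  \<comment> \<open>For negative \<open>a\<close> the point \<open>(b / a, 0)\<close> of the
    quadrant would lie on the separating line itself, against strictness; the same works for
    \<open>c\<close>.\<close>
  have a: "a \<ge> 0"
  proof (rule ccontr)
    assume "\<not> a \<ge> 0"
    then have "v \<bullet> (b / a, 0) = b" "b / a \<le> 0"
      using b by (auto simp: v field_simps)
    then show False
      using N[of "(b / a, 0)"] by (simp add: N_def)
  qed
  have c: "c \<ge> 0"
  proof (rule ccontr)
    assume "\<not> c \<ge> 0"
    then have "v \<bullet> (0, b / c) = b" "b / c \<le> 0"
      using b by (auto simp: v field_simps)
    then show False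
      using N[of "(0, b / c)"] by (simp add: N_def)
  qed
  have pos: "a * f p + c * g p > 0" if "p \<in> S" for p
  proof -
    have "(f p, g p) \<in> K" using that by (simp add: K_def)
    with K[of "(f p, g p)"] b show ?thesis by (simp add: v)
  qed
  have "a + c \<noteq> 0"
  proof
    assume "a + c = 0"
    then have "a = 0" "c = 0" using a c by auto
    moreover obtain p where "p \<in> S" using comb[of 0] by auto
    ultimately show False using pos[of p] by simp
  qed
  then have ac: "a + c > 0" using a c by simp
  moreover have "0 \<le> c / (a + c)" "c / (a + c) \<le> 1"
    using ac a c by (simp_all add: divide_le_eq)
  ultimately obtain p where "p \<in> S" and p: "(1 - c / (a + c)) * f p + c / (a + c) * g p \<le> 0"
    using comb by blast
  have "1 - c / (a + c) = a / (a + c)"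
    using ac by (simp add: field_simps)
  then have "(1 - c / (a + c)) * f p + c / (a + c) * g p = (a * f p + c * g p) / (a + c)"
    by (simp add: add_divide_distrib)
  with p ac pos[OF \<open>p \<in> S\<close>] show False
    by (simp add: divide_le_0_iff)
qed

text \<open>A minimax theorem of Fan type. Passing from \<open>S\<close> to \<open>{p \<in> S. \<phi> p \<le> 0}\<close> for one \<open>\<phi>\<close>
  preserves all hypotheses on \<open>S\<close>, which drives the induction.\<close>

lemma common_nonpos_finite:
  fixes \<Phi> :: "('b \<Rightarrow> real) set"
  assumes "finite \<Psi>" "\<Psi> \<subseteq> \<Phi>"
    and "compactin T S" "S \<noteq> {}"
    and cont: "\<And>\<phi>. \<phi> \<in> \<Phi> \<Longrightarrow> continuous_map T euclideanreal \<phi>"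
    and conv: "\<And>\<phi> \<psi> t. \<phi> \<in> \<Phi> \<Longrightarrow> \<psi> \<in> \<Phi> \<Longrightarrow> 0 \<le> t \<Longrightarrow> t \<le> 1 \<Longrightarrow>
      (\<lambda>p. (1 - t) * \<phi> p + t * \<psi> p) \<in> \<Phi>"
    and "\<And>p q t. p \<in> S \<Longrightarrow> q \<in> S \<Longrightarrow> 0 \<le> t \<Longrightarrow> t \<le> 1 \<Longrightarrow>
      \<exists>r\<in>S. \<forall>\<phi>\<in>\<Phi>. \<phi> r = (1 - t) * \<phi> p + t * \<phi> q"
    and "\<And>\<phi>. \<phi> \<in> \<Phi> \<Longrightarrow> \<exists>p\<in>S. \<phi> p \<le> 0"
  shows "\<exists>p\<in>S. \<forall>\<phi>\<in>\<Psi>. \<phi> p \<le> 0"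
  using assms(1-4,7,8)
proof (induction \<Psi> arbitrary: S rule: finite_induct)
  case empty
  then show ?case by auto
next
  case (insert f \<Psi>)
  note mix = insert.prems(4) and nonpos = insert.prems(5)
  define S' where "S' = {p \<in> S. f p \<le> 0}"
  have f: "f \<in> \<Phi>" using insert.prems by auto
  have "closedin T {p \<in> topspace T. f p \<in> {..0}}"
    using cont[OF f] by (rule closedin_continuous_map_preimage) auto
  moreover have "S' = {p \<in> topspace T. f p \<in> {..0}} \<inter> S"
    using compactin_subset_topspace[OF insert.prems(2)] by (auto simp: S'_def)
  ultimately have "compactin T S'"
    using closed_Int_compactin insert.prems(2) by metis
  moreover have "S' \<noteq> {}"
    using nonpos[OF f] by (auto simp: S'_def)
  moreover have "\<exists>r\<in>S'. \<forall>\<phi>\<in>\<Phi>. \<phi> r = (1 - t) * \<phi> p + t * \<phi> q"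
    if pq: "p \<in> S'" "q \<in> S'" and t: "0 \<le> t" "t \<le> 1" for p q t
  proof -
    obtain r where r: "r \<in> S" "\<forall>\<phi>\<in>\<Phi>. \<phi> r = (1 - t) * \<phi> p + t * \<phi> q"
      using mix[of p q t] pq t by (auto simp: S'_def)
    have "(1 - t) * f p + t * f q \<le> 0"
      using pq t by (intro add_nonpos_nonpos mult_nonneg_nonpos) (auto simp: S'_def)
    with r f show ?thesis by (auto simp: S'_def)
  qed
  moreover have "\<exists>p\<in>S'. \<phi> p \<le> 0" if \<phi>: "\<phi> \<in> \<Phi>" for \<phi>
  proof -
    \<comment> \<open>The one hypothesis that does not simply restrict to \<open>S'\<close>, since
      it asks for a single point serving two functions. All convex combinations of \<open>f\<close>
      and \<open>\<phi>\<close> lie in \<open>\<Phi>\<close>, so the two-function case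
      applies.\<close>
    have "\<exists>p\<in>S. f p \<le> 0 \<and> \<phi> p \<le> 0"
      using insert.prems(2) cont[OF f] cont[OF \<phi>]
    proof (rule common_nonpos_pair)
      fix p q and t :: real assume "p \<in> S" "q \<in> S" "0 \<le> t" "t \<le> 1"
      from mix[OF this]
      show "\<exists>r\<in>S. f r = (1 - t) * f p + t * f q \<and> \<phi> r = (1 - t) * \<phi> p + t * \<phi> q"
        using f \<phi> by blast
    next
      fix t :: real assume "0 \<le> t" "t \<le> 1"
      then show "\<exists>p\<in>S. (1 - t) * f p + t * \<phi> p \<le> 0"
        using nonpos[OF conv[OF f \<phi>]] by blast
    qed
    then show ?thesis by (auto simp: S'_def)
  qed
  ultimately have "\<exists>p\<in>S'. \<forall>\<phi>\<in>\<Psi>. \<phi> p \<le> 0"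
    using insert.prems(1) by (intro insert.IH) auto
  then show ?case by (auto simp: S'_def)
qed

text \<open>The sublevel sets \<open>C \<phi>\<close> are closed, and the finite case is their
  finite intersection property; compactness then gives a point common to all of them.\<close>

lemma common_nonpos:
  fixes \<Phi> :: "('b \<Rightarrow> real) set"
  assumes T: "compact_space T" "topspace T \<noteq> {}"
    and cont: "\<And>\<phi>. \<phi> \<in> \<Phi> \<Longrightarrow> continuous_map T euclideanreal \<phi>"
    and conv: "\<And>\<phi> \<psi> t. \<phi> \<in> \<Phi> \<Longrightarrow> \<psi> \<in> \<Phi> \<Longrightarrow> 0 \<le> t \<Longrightarrow> t \<le> 1 \<Longrightarrow>
      (\<lambda>p. (1 - t) * \<phi> p + t * \<psi> p) \<in> \<Phi>"
    and mix: "\<And>p q t. p \<in> topspace T \<Longrightarrow> q \<in> topspace T \<Longrightarrow> 0 \<le> t \<Longrightarrow> t \<le> 1 \<Longrightarrow>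
      \<exists>r\<in>topspace T. \<forall>\<phi>\<in>\<Phi>. \<phi> r = (1 - t) * \<phi> p + t * \<phi> q"
    and nonpos: "\<And>\<phi>. \<phi> \<in> \<Phi> \<Longrightarrow> \<exists>p\<in>topspace T. \<phi> p \<le> 0"
  shows "\<exists>p\<in>topspace T. \<forall>\<phi>\<in>\<Phi>. \<phi> p \<le> 0"
proof -
  define C where "C \<phi> = {p \<in> topspace T. \<phi> p \<in> {..0::real}}" for \<phi> :: "'b \<Rightarrow> real"
  have "closedin T (C \<phi>)" if "\<phi> \<in> \<Phi>" for \<phi>
    unfolding C_def using cont[OF that] by (rule closedin_continuous_map_preimage) auto
  moreover have "topspace T \<inter> \<Inter>\<F> \<noteq> {}" if \<F>: "finite \<F>" "\<F> \<subseteq> C ` \<Phi>" for \<F>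
  proof -
    obtain \<Psi> where \<Psi>: "finite \<Psi>" "\<Psi> \<subseteq> \<Phi>" "\<F> = C ` \<Psi>"
      using \<F> by (meson finite_subset_image)
    then obtain p where "p \<in> topspace T" "\<forall>\<phi>\<in>\<Psi>. \<phi> p \<le> 0"
      using common_nonpos_finite[OF \<Psi>(1,2) T(1)[unfolded compact_space_def] T(2) cont conv mix nonpos]
      by blast
    with \<Psi> show ?thesis by (auto simp: C_def)
  qed
  ultimately have "topspace T \<inter> \<Inter>(C ` \<Phi>) \<noteq> {}"
    using T(1) unfolding compact_space_def compactin_fip by blast
  then show ?thesis by (auto simp: C_def)
qed

section \<open>Extended expectations\<close>

lemma extE_integrable:
  assumes "integrable Q X"
  shows "extE Q X = ereal (\<integral>\<omega>. X \<omega> \<partial>Q)"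
proof -
  have "(\<integral>\<^sup>+ \<omega>. ennreal (X \<omega>) \<partial>Q) \<noteq> \<infinity>" "(\<integral>\<^sup>+ \<omega>. ennreal (- X \<omega>) \<partial>Q) \<noteq> \<infinity>"
    using assms by (auto simp: real_integrable_def)
  then show ?thesis
    unfolding extE_def Let_def real_lebesgue_integral_def[OF assms]
    by (cases "\<integral>\<^sup>+ \<omega>. ennreal (X \<omega>) \<partial>Q"; cases "\<integral>\<^sup>+ \<omega>. ennreal (- X \<omega>) \<partial>Q") auto
qed

lemma extE_nonneg:
  assumes "\<And>\<omega>. 0 \<le> X \<omega>"
  shows "extE Q X = enn2ereal (\<integral>\<^sup>+ \<omega>. ennreal (X \<omega>) \<partial>Q)"
proof -
  have "ennreal (- X \<omega>) = 0" for \<omega> using assms by (simp add: ennreal_neg)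
  then show ?thesis by (simp add: extE_def Let_def zero_ennreal.rep_eq)
qed

text \<open>If the positive part is infinite as well, this is the convention for
  \<open>\<infinity> - \<infinity>\<close>; otherwise it is ordinary subtraction.\<close>

lemma extE_neg_part_infinite:
  assumes "(\<integral>\<^sup>+ \<omega>. ennreal (- X \<omega>) \<partial>Q) = \<infinity>"
  shows "extE Q X = -\<infinity>"
  using assms unfolding extE_def Let_def
  by (cases "\<integral>\<^sup>+ \<omega>. ennreal (X \<omega>) \<partial>Q") auto

text \<open>Moving the negative part to the other side avoids differences of infinities and leaves
  two nonnegative integrals, which are additive under mixing of measures.\<close>

lemma ereal_le_extE_iff:
  "ereal c \<le> extE Q X \<longleftrightarrow>
    (\<integral>\<^sup>+ \<omega>. ennreal (- X \<omega>) \<partial>Q) \<noteq> \<infinity> \<and>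
    ereal c + enn2ereal (\<integral>\<^sup>+ \<omega>. ennreal (- X \<omega>) \<partial>Q) \<le> enn2ereal (\<integral>\<^sup>+ \<omega>. ennreal (X \<omega>) \<partial>Q)"
  unfolding extE_def Let_def
  by (cases "\<integral>\<^sup>+ \<omega>. ennreal (X \<omega>) \<partial>Q"; cases "\<integral>\<^sup>+ \<omega>. ennreal (- X \<omega>) \<partial>Q") auto

text \<open>Needed because members of \<open>A\<close> may fail to be integrable. If
  \<open>X\<close> is not integrable, \<open>extE Q X \<le> 0\<close> forces its negative part to be
  infinite: a finite one would make the positive part finite too. Adding an integrable
  \<open>Y\<close> cannot repair this, so the left side is \<open>-\<infinity>\<close>.\<close>

lemma extE_add_le:
  assumes Y: "integrable Q Y" and X: "X \<in> borel_measurable Q" "extE Q X \<le> 0"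
  shows "extE Q (\<lambda>\<omega>. Y \<omega> + X \<omega>) \<le> ereal (\<integral>\<omega>. Y \<omega> \<partial>Q)"
proof (cases "integrable Q X")
  case True
  with Y X(2) show ?thesis by (simp add: extE_integrable)
next
  case False
  note [measurable] = X(1) borel_measurable_integrable[OF Y]
  have inf: "\<infinity> = (\<integral>\<^sup>+ \<omega>. ennreal (- X \<omega>) \<partial>Q)"
  proof (rule ccontr)
    assume "\<infinity> \<noteq> (\<integral>\<^sup>+ \<omega>. ennreal (- X \<omega>) \<partial>Q)"
    then have *: "(\<integral>\<^sup>+ \<omega>. ennreal (- X \<omega>) \<partial>Q) \<noteq> \<infinity>" by simp
    then have "(\<integral>\<^sup>+ \<omega>. ennreal (X \<omega>) \<partial>Q) \<noteq> \<infinity>"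
      using X(2) by (cases "\<integral>\<^sup>+ \<omega>. ennreal (- X \<omega>) \<partial>Q") (auto simp: extE_def Let_def)
    with * X(1) False show False by (simp add: real_integrable_def)
  qed
  \<comment> \<open>The negative part of \<open>x\<close> is at most that of \<open>y + x\<close>
    plus the absolute value of \<open>y\<close>. Since the latter has finite integral, the negative
    part of the sum must carry the infinity.\<close>
  have le: "ennreal (- x) \<le> ennreal (- (y + x)) + ennreal \<bar>y\<bar>" for x y :: real
  proof -
    have "ennreal (- x) \<le> ennreal (max 0 (- (y + x)) + \<bar>y\<bar>)"
      by (rule ennreal_leI) auto
    then show ?thesis
      by (subst (asm) ennreal_plus) (auto simp: max_def ennreal_neg split: if_splits)
  qed
  note inf
  also have "(\<integral>\<^sup>+ \<omega>. ennreal (- X \<omega>) \<partial>Q) \<le>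
      (\<integral>\<^sup>+ \<omega>. ennreal (- (Y \<omega> + X \<omega>)) + ennreal \<bar>Y \<omega>\<bar> \<partial>Q)"
    by (intro nn_integral_mono le)
  also have "\<dots> = (\<integral>\<^sup>+ \<omega>. ennreal (- (Y \<omega> + X \<omega>)) \<partial>Q) + (\<integral>\<^sup>+ \<omega>. ennreal \<bar>Y \<omega>\<bar> \<partial>Q)"
    by (rule nn_integral_add) auto
  finally have "(\<integral>\<^sup>+ \<omega>. ennreal (- (Y \<omega> + X \<omega>)) \<partial>Q) = \<infinity>"
    using Y by (auto simp: integrable_iff_bounded top_unique)
  then show ?thesis by (simp add: extE_neg_part_infinite)
qed

section \<open>Mixtures of densities and convexity of the determining set\<close>

lemma nn_integral_density_mix:
  fixes f g :: "'a \<Rightarrow> real" and t :: real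
  assumes [measurable]: "f \<in> borel_measurable M" "g \<in> borel_measurable M" "h \<in> borel_measurable M"
    and fg: "AE \<omega> in M. 0 \<le> f \<omega>" "AE \<omega> in M. 0 \<le> g \<omega>" and t: "0 \<le> t" "t \<le> 1"
  shows "(\<integral>\<^sup>+ \<omega>. h \<omega> \<partial>density M (\<lambda>\<omega>. ennreal ((1 - t) * f \<omega> + t * g \<omega>))) =
    ennreal (1 - t) * (\<integral>\<^sup>+ \<omega>. h \<omega> \<partial>density M f) + ennreal t * (\<integral>\<^sup>+ \<omega>. h \<omega> \<partial>density M g)"
proof -
  have "(\<integral>\<^sup>+ \<omega>. h \<omega> \<partial>density M (\<lambda>\<omega>. ennreal ((1 - t) * f \<omega> + t * g \<omega>))) =
      (\<integral>\<^sup>+ \<omega>. ennreal ((1 - t) * f \<omega> + t * g \<omega>) * h \<omega> \<partial>M)"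
    by (simp add: nn_integral_density)
  also have "\<dots> = (\<integral>\<^sup>+ \<omega>. ennreal (1 - t) * (ennreal (f \<omega>) * h \<omega>) + ennreal t * (ennreal (g \<omega>) * h \<omega>) \<partial>M)"
    using fg
    by (intro nn_integral_cong_AE, eventually_elim)
      (use t in \<open>simp add: ennreal_plus ennreal_mult distrib_right mult.assoc\<close>)
  also have "\<dots> = ennreal (1 - t) * (\<integral>\<^sup>+ \<omega>. h \<omega> \<partial>density M f) + ennreal t * (\<integral>\<^sup>+ \<omega>. h \<omega> \<partial>density M g)"
    by (simp add: nn_integral_add nn_integral_cmult nn_integral_density)
  finally show ?thesis .
qed

lemma densitiesD:
  assumes "f \<in> densities M \<D>"
  shows "integrable M f" "f \<in> borel_measurable M" "AE \<omega> in M. 0 \<le> f \<omega>"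
    "density M (\<lambda>\<omega>. ennreal (f \<omega>)) \<in> \<D>"
  using assms by (auto simp: densities_def)

lemma represents_le:
  assumes "represents M \<D> u" "Q \<in> \<D>" "X \<in> L0 M"
  shows "u X \<le> extE Q X"
  using assms by (auto simp: represents_def intro: INF_lower)

text \<open>Convexity comes from maximality. Any real level below the expectations of
  \<open>X\<close> under both measures is also below the one under the mixture \<open>Q\<close>, so
  \<open>u X \<le> extE Q X\<close> for every \<open>X\<close>. Inserting \<open>Q\<close> into
  \<open>\<D>\<close> thus leaves all infima unchanged, and the largest representing set already
  contains it.\<close>

lemma densities_mix:
  assumes \<D>: "is_determining_set M u \<D>"
    and fg: "f \<in> densities M \<D>" "g \<in> densities M \<D>" and t: "0 \<le> t" "t \<le> 1"
  shows "(\<lambda>\<omega>. (1 - t) * f \<omega> + t * g \<omega>) \<in> densities M \<D>"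
\<comment> \<open>The endpoints are split off because an infinite positive part survives mixing only
  under a strictly positive weight.\<close>
proof (cases "0 < t \<and> t < 1")
  case False
  then have "t = 0 \<or> t = 1" using t by auto
  with fg show ?thesis by auto
next
  case True
  note f = densitiesD[OF fg(1)] and g = densitiesD[OF fg(2)]
  note [measurable] = f(2) g(2)
  define Q where "Q = density M (\<lambda>\<omega>. ennreal ((1 - t) * f \<omega> + t * g \<omega>))"
  have rep: "represents M \<D> u" and max: "\<And>\<D>'. represents M \<D>' u \<Longrightarrow> \<D>' \<subseteq> \<D>"
    using \<D> by (auto simp: is_determining_set_def)
  have "density M f \<in> ac_probs M" "density M g \<in> ac_probs M"
    using rep f(4) g(4) by (auto simp: represents_def)
  then have "prob_space (density M f)" "prob_space (density M g)"
    by (auto simp: ac_probs_def)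
  then have "emeasure (density M f) (space M) = 1" "emeasure (density M g) (space M) = 1"
    by (auto dest: prob_space.emeasure_space_1)
  then have one: "(\<integral>\<^sup>+ \<omega>. 1 \<partial>density M f) = 1" "(\<integral>\<^sup>+ \<omega>. 1 \<partial>density M g) = 1"
    by simp_all
  have "(\<integral>\<^sup>+ \<omega>. 1 \<partial>Q) = ennreal (1 - t) * 1 + ennreal t * 1"
    unfolding Q_def nn_integral_density_mix[OF f(2) g(2) borel_measurable_const f(3) g(3) t] one ..
  also have "\<dots> = 1"
    using t by (simp flip: ennreal_plus)
  finally have "prob_space Q"
    by (auto intro: prob_spaceI)
  then have Q: "Q \<in> ac_probs M"
    by (auto simp: ac_probs_def Q_def intro: absolutely_continuousI_density)
  have "u X \<le> extE Q X" if X: "X \<in> L0 M" for X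
  proof (rule ccontr)
    assume "\<not> u X \<le> extE Q X"
    \<comment> \<open>A real level in between is used because both sides may be infinite.\<close>
    then obtain c where "extE Q X < ereal c" "ereal c < u X"
      using ereal_dense2[of "extE Q X" "u X"] by (auto simp: not_le)
    moreover have "u X \<le> extE R X" if "R \<in> \<D>" for R
      using represents_le[OF rep that X] .
    ultimately have c: "extE Q X < ereal c" "ereal c \<le> extE (density M f) X"
      "ereal c \<le> extE (density M g) X"
      using f(4) g(4) by (auto intro: less_imp_le less_le_trans)
    note [measurable] = X
    define pf mf pg mg where "pf = (\<integral>\<^sup>+ \<omega>. ennreal (X \<omega>) \<partial>density M f)"
      and "mf = (\<integral>\<^sup>+ \<omega>. ennreal (- X \<omega>) \<partial>density M f)"
      and "pg = (\<integral>\<^sup>+ \<omega>. ennreal (X \<omega>) \<partial>density M g)"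
      and "mg = (\<integral>\<^sup>+ \<omega>. ennreal (- X \<omega>) \<partial>density M g)"
    note defs = this
    have "(\<integral>\<^sup>+ \<omega>. ennreal (X \<omega>) \<partial>Q) = ennreal (1 - t) * pf + ennreal t * pg"
      "(\<integral>\<^sup>+ \<omega>. ennreal (- X \<omega>) \<partial>Q) = ennreal (1 - t) * mf + ennreal t * mg"
      unfolding Q_def defs by (intro nn_integral_density_mix f g t; measurable)+
    note Q_eq = this
    \<comment> \<open>Expectations above a real level have finite negative parts, so only the
      positive parts can still be infinite.\<close>
    obtain m1 m2 where m: "mf = ennreal m1" "mg = ennreal m2" "0 \<le> m1" "0 \<le> m2"
      using c(2,3) unfolding ereal_le_extE_iff by (cases mf; cases mg) (auto simp: defs)
    have le: "ereal c + ereal m1 \<le> enn2ereal pf" "ereal c + ereal m2 \<le> enn2ereal pg"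
      using c(2,3) m unfolding ereal_le_extE_iff defs[symmetric] by auto
    have "ereal c \<le> extE Q X"
    proof (cases "pf = \<infinity> \<or> pg = \<infinity>")
      case True
      with \<open>0 < t \<and> t < 1\<close> have "ennreal (1 - t) * pf + ennreal t * pg = \<infinity>"
        by (auto simp: ennreal_mult_top ennreal_top_mult ennreal_mult_eq_top_iff)
      then show ?thesis
        unfolding ereal_le_extE_iff Q_eq using m t by (auto simp flip: ennreal_mult ennreal_plus)
    next
      case False
      then obtain p1 p2 where p: "pf = ennreal p1" "pg = ennreal p2" "0 \<le> p1" "0 \<le> p2"
        by (cases pf; cases pg) auto
      have "(1 - t) * (c + m1) + t * (c + m2) \<le> (1 - t) * p1 + t * p2"
        using le p t by (intro add_mono mult_left_mono) auto
      then have "c + ((1 - t) * m1 + t * m2) \<le> (1 - t) * p1 + t * p2"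
        by (simp add: algebra_simps)
      then show ?thesis
        unfolding ereal_le_extE_iff Q_eq m p using m p t
        by (simp flip: ennreal_mult ennreal_plus)
    qed
    with c(1) show False by simp
  qed
  then have "represents M (insert Q \<D>) u"
    using rep Q by (auto simp: represents_def inf.absorb2 Inf_insert)
  then have "Q \<in> \<D>" using max by blast
  moreover have "AE \<omega> in M. 0 \<le> (1 - t) * f \<omega> + t * g \<omega>"
    using f(3) g(3) by eventually_elim (use t in auto)
  ultimately show ?thesis
    using f(1) g(1) by (auto simp: densities_def Q_def)
qed

text \<open>Radon-Nikodym, as the bridge from measures to the functions on which the weak topology
  lives. Finiteness of \<open>Q\<close> gives a real version of the derivative, and total mass 1
  makes it integrable.\<close>

lemma representing_density:
  assumes "prob_space M" "\<D> \<subseteq> ac_probs M" "Q \<in> \<D>"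
  obtains f where "f \<in> densities M \<D>" "Q = density M (\<lambda>\<omega>. ennreal (f \<omega>))"
proof -
  interpret M: prob_space M by fact
  have Q: "prob_space Q" "sets Q = sets M" "absolutely_continuous M Q"
    using assms by (auto simp: ac_probs_def)
  interpret Q: prob_space Q by fact
  obtain f where [measurable]: "f \<in> borel_measurable M"
    and f: "AE \<omega> in M. RN_deriv M Q \<omega> = ennreal (f \<omega>)" "\<And>\<omega>. 0 \<le> f \<omega>"
    using M.real_RN_deriv[OF Q.finite_measure_axioms Q(3,2)] by metis
  have "Q = density M (RN_deriv M Q)"
    using M.density_RN_deriv[OF Q(3,2)] by simp
  also have "\<dots> = density M (\<lambda>\<omega>. ennreal (f \<omega>))"
    using f by (intro density_cong) auto
  finally have eq: "Q = density M (\<lambda>\<omega>. ennreal (f \<omega>))" .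
  have "(\<integral>\<^sup>+ \<omega>. ennreal (f \<omega>) \<partial>M) = emeasure Q (space M)"
    unfolding eq by (simp add: emeasure_density cong: nn_integral_cong)
  also have "\<dots> = 1"
    using Q.emeasure_space_1 sets_eq_imp_space_eq[OF Q(2)] by simp
  finally have "integrable M f"
    using f by (intro integrableI_nonneg) auto
  with assms f eq show thesis
    by (intro that[of f]) (auto simp: densities_def)
qed

section \<open>Uniformly small tails and weak continuity\<close>

lemma L1s_tail:
  assumes "X \<in> L1s M \<D>" "0 < \<epsilon>"
  shows "\<forall>\<^sub>F n in sequentially. \<forall>Q\<in>\<D>.
    extE Q (\<lambda>\<omega>. \<bar>X \<omega>\<bar> * indicator {\<omega>. \<bar>X \<omega>\<bar> > real n} \<omega>) < ereal \<epsilon>"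
proof -
  have "(\<lambda>n::nat. SUP Q\<in>\<D>. extE Q (\<lambda>\<omega>. \<bar>X \<omega>\<bar> * indicator {\<omega>. \<bar>X \<omega>\<bar> > real n} \<omega>)) \<longlonglongrightarrow> 0"
    using assms by (simp add: L1s_def)
  moreover have "0 < ereal \<epsilon>" using assms(2) by simp
  ultimately have "\<forall>\<^sub>F n in sequentially.
      (SUP Q\<in>\<D>. extE Q (\<lambda>\<omega>. \<bar>X \<omega>\<bar> * indicator {\<omega>. \<bar>X \<omega>\<bar> > real n} \<omega>)) < ereal \<epsilon>"
    by (rule order_tendstoD(2))
  then show ?thesis
  proof eventually_elim
    case (elim n)
    show ?case
    proof
      fix Q assume "Q \<in> \<D>"
      then have "extE Q (\<lambda>\<omega>. \<bar>X \<omega>\<bar> * indicator {\<omega>. \<bar>X \<omega>\<bar> > real n} \<omega>) \<le>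
          (SUP Q\<in>\<D>. extE Q (\<lambda>\<omega>. \<bar>X \<omega>\<bar> * indicator {\<omega>. \<bar>X \<omega>\<bar> > real n} \<omega>))"
        by (rule SUP_upper)
      also note elim
      finally show "extE Q (\<lambda>\<omega>. \<bar>X \<omega>\<bar> * indicator {\<omega>. \<bar>X \<omega>\<bar> > real n} \<omega>) < ereal \<epsilon>" .
    qed
  qed
qed

text \<open>The absolute value of \<open>X\<close> is at most its tail plus \<open>n\<close>, which
  is integrable under a probability measure. The error of truncating at \<open>n\<close> is at most
  the expected tail.\<close>

lemma tail_bound:
  assumes "prob_space Q" and X [measurable]: "X \<in> borel_measurable Q"
    and tail: "extE Q (\<lambda>\<omega>. \<bar>X \<omega>\<bar> * indicator {\<omega>. \<bar>X \<omega>\<bar> > real n} \<omega>) < ereal \<epsilon>"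
  shows "integrable Q X"
    and "\<bar>(\<integral>\<omega>. X \<omega> * indicator {\<omega>. \<bar>X \<omega>\<bar> \<le> real n} \<omega> \<partial>Q) - (\<integral>\<omega>. X \<omega> \<partial>Q)\<bar> < \<epsilon>"
proof -
  interpret prob_space Q by fact
  define Y where "Y \<omega> = \<bar>X \<omega>\<bar> * indicator {\<omega>. \<bar>X \<omega>\<bar> > real n} \<omega>" for \<omega>
  have [measurable]: "Y \<in> borel_measurable Q" unfolding Y_def by measurable
  have "enn2ereal (\<integral>\<^sup>+ \<omega>. ennreal (Y \<omega>) \<partial>Q) < ereal \<epsilon>"
    using tail unfolding Y_def[symmetric] by (subst (asm) extE_nonneg) (auto simp: Y_def)
  then have "(\<integral>\<^sup>+ \<omega>. ennreal (Y \<omega>) \<partial>Q) < \<infinity>"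
    by (cases "\<integral>\<^sup>+ \<omega>. ennreal (Y \<omega>) \<partial>Q") auto
  then have Y: "integrable Q Y"
    by (intro integrableI_nonneg) (auto simp: Y_def)
  have "integrable Q (\<lambda>\<omega>. Y \<omega> + real n)" using Y by simp
  then show int: "integrable Q X"
    by (rule Bochner_Integration.integrable_bound) (auto simp: Y_def indicator_def)
  have "integrable Q (\<lambda>\<omega>. X \<omega> * indicator {\<omega>. \<bar>X \<omega>\<bar> \<le> real n} \<omega>)"
    by (rule Bochner_Integration.integrable_bound[OF int]) (auto simp: indicator_def)
  then have "(\<integral>\<omega>. X \<omega> * indicator {\<omega>. \<bar>X \<omega>\<bar> \<le> real n} \<omega> \<partial>Q) - (\<integral>\<omega>. X \<omega> \<partial>Q) =
      (\<integral>\<omega>. X \<omega> * indicator {\<omega>. \<bar>X \<omega>\<bar> \<le> real n} \<omega> - X \<omega> \<partial>Q)"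
    using int by simp
  also have "\<bar>\<dots>\<bar> \<le> (\<integral>\<omega>. \<bar>X \<omega> * indicator {\<omega>. \<bar>X \<omega>\<bar> \<le> real n} \<omega> - X \<omega>\<bar> \<partial>Q)"
    by (rule integral_abs_bound)
  also have "\<dots> = (\<integral>\<omega>. Y \<omega> \<partial>Q)"
    by (intro Bochner_Integration.integral_cong) (auto simp: Y_def indicator_def)
  also have "\<dots> < \<epsilon>"
    using tail unfolding Y_def[symmetric] by (simp add: extE_integrable Y)
  finally show "\<bar>(\<integral>\<omega>. X \<omega> * indicator {\<omega>. \<bar>X \<omega>\<bar> \<le> real n} \<omega> \<partial>Q) - (\<integral>\<omega>. X \<omega> \<partial>Q)\<bar> < \<epsilon>" .
qed

text \<open>A working class containing \<open>L1s M \<D>\<close> whose closure under linear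
  operations is immediate. Integrability is demanded separately because the Bochner integral
  defaults to 0 and would not be additive without it.\<close>

definition continuous_rvs :: "'a measure \<Rightarrow> 'a measure set \<Rightarrow> ('a \<Rightarrow> real) set" where
  "continuous_rvs M \<D> = {X \<in> L0 M.
    (\<forall>f\<in>densities M \<D>. integrable (density M f) X) \<and>
    continuous_map (subtopology (weak_L1 M) (densities M \<D>)) euclideanreal
      (\<lambda>f. \<integral>\<omega>. X \<omega> \<partial>density M f)}"

lemma topspace_weak_L1: "topspace (weak_L1 M) = {f. integrable M f}"
proof -
  \<comment> \<open>The subbasic set of the test function 0 with \<open>U = UNIV\<close> is already
    the whole space.\<close>
  have "(\<lambda>_. 0) \<in> Linf M" by (auto simp: Linf_def)
  then have "{f. integrable M f} \<in>
      {{f. integrable M f \<and> (\<integral>\<omega>. f \<omega> * g \<omega> \<partial>M) \<in> U} | g U. g \<in> Linf M \<and> open U}"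
    by (intro CollectI exI[of _ "\<lambda>_. 0"] exI[of _ UNIV]) auto
  then show ?thesis
    unfolding weak_L1_def topology_generated_by_topspace by blast
qed

lemma topspace_weak_densities:
  "topspace (subtopology (weak_L1 M) (densities M \<D>)) = densities M \<D>"
  by (auto simp: topspace_weak_L1 densities_def)

text \<open>Integrating \<open>f * g\<close> against \<open>M\<close> is continuous by the choice of
  subbasis. It agrees with the integral of \<open>g\<close> under \<open>density M f\<close> when
  \<open>f\<close> is nonnegative almost everywhere, as \<open>ennreal\<close> cuts off negative
  values; hence the restriction to \<open>densities M \<D>\<close>.\<close>

lemma Linf_continuous:
  assumes g: "g \<in> Linf M"
  shows "continuous_map (subtopology (weak_L1 M) (densities M \<D>)) euclideanreal
    (\<lambda>f. \<integral>\<omega>. g \<omega> \<partial>density M f)"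
proof (rule continuous_map_eq)
  have "openin (weak_L1 M) {f. integrable M f \<and> (\<integral>\<omega>. f \<omega> * g \<omega> \<partial>M) \<in> U}" if "open U" for U
    unfolding weak_L1_def using g that by (intro topology_generated_by_Basis) auto
  then have "continuous_map (weak_L1 M) euclideanreal (\<lambda>f. \<integral>\<omega>. f \<omega> * g \<omega> \<partial>M)"
    by (auto simp: continuous_map_def topspace_weak_L1)
  then show "continuous_map (subtopology (weak_L1 M) (densities M \<D>)) euclideanreal
      (\<lambda>f. \<integral>\<omega>. f \<omega> * g \<omega> \<partial>M)"
    by (rule continuous_map_from_subtopology)
next
  fix f assume "f \<in> topspace (subtopology (weak_L1 M) (densities M \<D>))"
  then have "f \<in> densities M \<D>" by (simp only: topspace_weak_densities)
  then show "(\<integral>\<omega>. f \<omega> * g \<omega> \<partial>M) = (\<integral>\<omega>. g \<omega> \<partial>density M f)"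
    using densitiesD(2,3)[of f] g by (subst integral_density) (auto simp: Linf_def)
qed

text \<open>Truncations of \<open>X\<close> are bounded, so their expectations are weakly continuous
  in the density. Small tails make these converge uniformly over \<open>\<D>\<close>, and a uniform
  limit of continuous functions is continuous.\<close>

lemma L1s_subset_continuous_rvs:
  assumes "\<D> \<subseteq> ac_probs M"
  shows "L1s M \<D> \<subseteq> continuous_rvs M \<D>"
proof
  fix X assume X: "X \<in> L1s M \<D>"
  then have [measurable]: "X \<in> L0 M" by (simp add: L1s_def)
  have prob: "prob_space (density M f)" if "f \<in> densities M \<D>" for f
    using densitiesD(4)[OF that] assms by (auto simp: ac_probs_def)
  define trunc where "trunc n \<omega> = X \<omega> * indicator {\<omega>. \<bar>X \<omega>\<bar> \<le> real n} \<omega>" for n \<omega>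
  have "trunc n \<in> Linf M" for n
    unfolding Linf_def trunc_def by (auto intro!: exI[of _ "real n"] simp: indicator_def)
  moreover have "\<forall>\<^sub>F n in sequentially. \<forall>f\<in>densities M \<D>.
      dist (\<integral>\<omega>. trunc n \<omega> \<partial>density M f) (\<integral>\<omega>. X \<omega> \<partial>density M f) < \<epsilon>" if "\<epsilon> > 0" for \<epsilon>
    using L1s_tail[OF X that]
  proof eventually_elim
    case (elim n)
    show ?case
    proof
      fix f assume f: "f \<in> densities M \<D>"
      have "X \<in> borel_measurable (density M f)" by simp
      from tail_bound(2)[OF prob[OF f] this elim[rule_format, OF densitiesD(4)[OF f]]]
      show "dist (\<integral>\<omega>. trunc n \<omega> \<partial>density M f) (\<integral>\<omega>. X \<omega> \<partial>density M f) < \<epsilon>"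
        by (simp add: dist_real_def trunc_def)
    qed
  qed
  ultimately have "continuous_map (subtopology (weak_L1 M) (densities M \<D>)) euclideanreal
      (\<lambda>f. \<integral>\<omega>. X \<omega> \<partial>density M f)"
    by (intro Met_TC.continuous_map_uniform_limit_alt[where F = sequentially and
          f = "\<lambda>n f. \<integral>\<omega>. trunc n \<omega> \<partial>density M (\<lambda>\<omega>. ennreal (f \<omega>))", unfolded mtopology_is_euclidean])
      (simp_all add: Linf_continuous topspace_weak_densities del: topspace_subtopology)
  moreover have "integrable (density M f) X" if f: "f \<in> densities M \<D>" for f
  proof -
    \<comment> \<open>For integrability any finite tail bound suffices; 1 is arbitrary.\<close>
    obtain n where "\<forall>Q\<in>\<D>. extE Q (\<lambda>\<omega>. \<bar>X \<omega>\<bar> * indicator {\<omega>. \<bar>X \<omega>\<bar> > real n} \<omega>) < ereal 1"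
      using eventually_happens'[OF sequentially_bot L1s_tail[OF X zero_less_one]] by blast
    with tail_bound(1)[OF prob[OF f], of X n 1] densitiesD(4)[OF f] show ?thesis by simp
  qed
  ultimately show "X \<in> continuous_rvs M \<D>"
    by (simp add: continuous_rvs_def)
qed

lemma continuous_rvs_add:
  assumes "X \<in> continuous_rvs M \<D>" "Y \<in> continuous_rvs M \<D>"
  shows "(\<lambda>\<omega>. X \<omega> + Y \<omega>) \<in> continuous_rvs M \<D>"
proof -
  have "continuous_map (subtopology (weak_L1 M) (densities M \<D>)) euclideanreal
      (\<lambda>f. (\<integral>\<omega>. X \<omega> \<partial>density M f) + (\<integral>\<omega>. Y \<omega> \<partial>density M f))"
    using assms by (intro continuous_map_add) (auto simp: continuous_rvs_def)
  then have "continuous_map (subtopology (weak_L1 M) (densities M \<D>)) euclideanreal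
      (\<lambda>f. \<integral>\<omega>. X \<omega> + Y \<omega> \<partial>density M f)"
    by (rule continuous_map_eq) (use assms in \<open>auto simp: continuous_rvs_def\<close>)
  with assms show ?thesis
    by (simp add: continuous_rvs_def borel_measurable_add)
qed

lemma continuous_rvs_scale:
  assumes "X \<in> continuous_rvs M \<D>"
  shows "(\<lambda>\<omega>. c * X \<omega>) \<in> continuous_rvs M \<D>"
  using assms by (auto simp: continuous_rvs_def intro: continuous_map_real_mult_left)

lemma continuous_rvs_const:
  assumes "\<D> \<subseteq> ac_probs M"
  shows "(\<lambda>_. c) \<in> continuous_rvs M \<D>"
proof -
  have "integrable (density M f) (\<lambda>_. c)" if "f \<in> densities M \<D>" for f
  proof -
    interpret prob_space "density M f"
      using densitiesD(4)[OF that] assms by (auto simp: ac_probs_def)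
    show ?thesis by simp
  qed
  moreover have "(\<lambda>_. c) \<in> Linf M" by (auto simp: Linf_def)
  ultimately show ?thesis
    using Linf_continuous[of "\<lambda>_. c" M \<D>] by (auto simp: continuous_rvs_def)
qed

section \<open>Attained infima and minimax over the determining set\<close>

text \<open>A continuous real function attains its minimum on a compact set; Radon-Nikodym turns the
  infimum over \<open>\<D>\<close> into one over densities.\<close>

lemma utility_attained:
  assumes M: "prob_space M" and rep: "represents M \<D> u" and comp: "weakly_compact M \<D>"
    and X: "X \<in> continuous_rvs M \<D>"
  shows "\<exists>f\<in>densities M \<D>. u X = ereal (\<integral>\<omega>. X \<omega> \<partial>density M f)"
proof -
  let ?J = "\<lambda>f. \<integral>\<omega>. X \<omega> \<partial>density M f"
  have \<D>: "\<D> \<noteq> {}" "\<D> \<subseteq> ac_probs M" and u: "u X = (INF Q\<in>\<D>. extE Q X)"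
    using rep X by (auto simp: represents_def continuous_rvs_def)
  have J: "extE (density M f) X = ereal (?J f)" if "f \<in> densities M \<D>" for f
    using X that by (auto simp: continuous_rvs_def intro: extE_integrable)
  have "compactin (subtopology (weak_L1 M) (densities M \<D>)) (densities M \<D>)"
    using comp by (simp add: weakly_compact_def compactin_subtopology)
  moreover have "continuous_map (subtopology (weak_L1 M) (densities M \<D>)) euclideanreal ?J"
    using X by (simp add: continuous_rvs_def)
  ultimately have "compactin euclideanreal (?J ` densities M \<D>)"
    by (rule image_compactin)
  then have "compact (?J ` densities M \<D>)" by simp
  moreover have "densities M \<D> \<noteq> {}"
    using \<D> representing_density[OF M \<D>(2)] by blast
  ultimately obtain f where f: "f \<in> densities M \<D>" and
    min: "\<And>g. g \<in> densities M \<D> \<Longrightarrow> ?J f \<le> ?J g"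
    using compact_attains_inf[of "?J ` densities M \<D>"] by auto
  have "u X \<le> ereal (?J f)"
    unfolding u using densitiesD(4)[OF f] by (intro INF_lower2[of "density M f"]) (simp_all add: J f)
  moreover have "ereal (?J f) \<le> u X"
    unfolding u
  proof (rule INF_greatest)
    fix Q assume "Q \<in> \<D>"
    then obtain g where "g \<in> densities M \<D>" "Q = density M g"
      using representing_density[OF M \<D>(2)] by blast
    with min J show "ereal (?J f) \<le> extE Q X" by simp
  qed
  ultimately show ?thesis using f by (auto intro: antisym)
qed

text \<open>Exchanges quantifiers: each \<open>Y\<close> has its own minimising density with
  expectation at most \<open>a\<close>, and minimax produces one density for all of
  \<open>C\<close>. Mixtures exist on one side because \<open>\<D>\<close> is convex, on the other
  because \<open>C\<close> is.\<close>

lemma minimax_measure: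
  assumes M: "prob_space M" and det: "is_determining_set M u \<D>" and comp: "weakly_compact M \<D>"
    and C: "C \<subseteq> continuous_rvs M \<D>" "convex_rvs C"
    and le: "\<And>Y. Y \<in> C \<Longrightarrow> u Y \<le> ereal a"
  shows "\<exists>f\<in>densities M \<D>. \<forall>Y\<in>C. (\<integral>\<omega>. Y \<omega> \<partial>density M f) \<le> a"
proof -
  let ?T = "subtopology (weak_L1 M) (densities M \<D>)"
  define \<phi> where "\<phi> Y f = (\<integral>\<omega>. Y \<omega> \<partial>density M f) - a" for Y f :: "'a \<Rightarrow> real"
  \<comment> \<open>Cut off outside \<open>densities M \<D>\<close>, where \<open>Y\<close> may fail to be integrable, so that
    \<open>\<phi> Y\<close> need not be affine in \<open>Y\<close>.\<close>
  define \<Phi> where "\<Phi> = (\<lambda>Y f. if f \<in> densities M \<D> then \<phi> Y f else 0) ` C"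
  have rep: "represents M \<D> u" using det by (simp add: is_determining_set_def)
  then have \<D>: "\<D> \<noteq> {}" "\<D> \<subseteq> ac_probs M" by (auto simp: represents_def)
  have int: "integrable (density M f) Y" if "Y \<in> C" "f \<in> densities M \<D>" for Y f
    using C that by (auto simp: continuous_rvs_def)
  have "\<exists>f\<in>topspace ?T. \<forall>\<psi>\<in>\<Phi>. \<psi> f \<le> 0"
  proof (rule common_nonpos)
    show "compact_space ?T"
      using comp by (simp add: weakly_compact_def compact_space_subtopology)
    show "topspace ?T \<noteq> {}"
      unfolding topspace_weak_densities using \<D> representing_density[OF M \<D>(2)] by blast
  next
    fix \<psi> assume "\<psi> \<in> \<Phi>"
    then obtain Y where Y: "Y \<in> C" and \<psi>: "\<psi> = (\<lambda>f. if f \<in> densities M \<D> then \<phi> Y f else 0)"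
      by (auto simp: \<Phi>_def)
    have "continuous_map ?T euclideanreal (\<phi> Y)"
      unfolding \<phi>_def using C Y by (intro continuous_map_diff) (auto simp: continuous_rvs_def)
    then show "continuous_map ?T euclideanreal \<psi>"
      by (rule continuous_map_eq) (simp add: \<psi>)
    show "\<exists>f\<in>topspace ?T. \<psi> f \<le> 0"
    proof -
      obtain f where f: "f \<in> densities M \<D>" and "u Y = ereal (\<integral>\<omega>. Y \<omega> \<partial>density M f)"
        using utility_attained[OF M rep comp] C Y by blast
      with le[OF Y] have "\<psi> f \<le> 0" by (simp add: \<psi> \<phi>_def)
      with f show ?thesis unfolding topspace_weak_densities by blast
    qed
  next
    fix \<psi>1 \<psi>2 and t :: real assume "\<psi>1 \<in> \<Phi>" "\<psi>2 \<in> \<Phi>" and t: "0 \<le> t" "t \<le> 1"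
    then obtain Y Z where YZ: "Y \<in> C" "Z \<in> C"
      and \<psi>: "\<psi>1 = (\<lambda>f. if f \<in> densities M \<D> then \<phi> Y f else 0)"
        "\<psi>2 = (\<lambda>f. if f \<in> densities M \<D> then \<phi> Z f else 0)"
      by (auto simp: \<Phi>_def)
    \<comment> \<open>The shift by \<open>a\<close> is preserved since the weights sum to 1.\<close>
    have "(\<lambda>\<omega>. (1 - t) * Y \<omega> + t * Z \<omega>) \<in> C"
      using C(2) YZ t by (auto simp: convex_rvs_def)
    then show "(\<lambda>f. (1 - t) * \<psi>1 f + t * \<psi>2 f) \<in> \<Phi>"
      unfolding \<Phi>_def
      by (rule rev_image_eqI) (auto simp: \<psi> \<phi>_def int YZ algebra_simps)
  next
    fix f g and t :: real
    assume "f \<in> topspace ?T" "g \<in> topspace ?T" and t: "0 \<le> t" "t \<le> 1"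
    then have fg: "f \<in> densities M \<D>" "g \<in> densities M \<D>"
      by (simp_all only: topspace_weak_densities)
    define r where "r = (\<lambda>\<omega>. (1 - t) * f \<omega> + t * g \<omega>)"
    have r: "r \<in> densities M \<D>"
      unfolding r_def using densities_mix[OF det fg t] .
    have "\<phi> Y r = (1 - t) * \<phi> Y f + t * \<phi> Y g" if Y: "Y \<in> C" for Y
    proof -
      have [measurable]: "Y \<in> borel_measurable M" using C Y by (auto simp: continuous_rvs_def)
      \<comment> \<open>Written as an integral against \<open>M\<close>, the expectation is visibly
        linear in the density.\<close>
      have eq: "(\<integral>\<omega>. Y \<omega> \<partial>density M h) = (\<integral>\<omega>. h \<omega> * Y \<omega> \<partial>M)" "integrable M (\<lambda>\<omega>. h \<omega> * Y \<omega>)"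
        if h: "h \<in> densities M \<D>" for h
        using densitiesD(2,3)[OF h] int[OF Y h] by (simp_all add: integral_density integrable_density)
      have "(\<integral>\<omega>. Y \<omega> \<partial>density M r) = (\<integral>\<omega>. (1 - t) * (f \<omega> * Y \<omega>) + t * (g \<omega> * Y \<omega>) \<partial>M)"
        unfolding eq(1)[OF r] by (simp add: r_def algebra_simps)
      also have "\<dots> = (1 - t) * (\<integral>\<omega>. Y \<omega> \<partial>density M f) + t * (\<integral>\<omega>. Y \<omega> \<partial>density M g)"
        using eq[OF fg(1)] eq[OF fg(2)] by simp
      finally show ?thesis by (simp add: \<phi>_def algebra_simps)
    qed
    then show "\<exists>r\<in>topspace ?T. \<forall>\<psi>\<in>\<Phi>. \<psi> r = (1 - t) * \<psi> f + t * \<psi> g"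
      unfolding topspace_weak_densities using r fg by (intro bexI[of _ r]) (auto simp: \<Phi>_def)
  qed
  then obtain f where f: "f \<in> densities M \<D>" and nonpos: "\<forall>\<psi>\<in>\<Phi>. \<psi> f \<le> 0"
    unfolding topspace_weak_densities by blast
  have "(\<integral>\<omega>. Y \<omega> \<partial>density M f) \<le> a" if "Y \<in> C" for Y
    using nonpos f that by (auto simp: \<Phi>_def \<phi>_def)
  with f show ?thesis by blast
qed

section \<open>Prices as expectations under extreme risk-neutral measures\<close>

theorem theorem3p8:
  fixes M :: "'a measure"
    and u :: "('a \<Rightarrow> real) \<Rightarrow> ereal"
    and \<D> :: "'a measure set"
    and A :: "('a \<Rightarrow> real) set"
    and W F :: "'a \<Rightarrow> real"
  assumes "prob_space M"
    and "coherent_utility M u"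
    and "is_determining_set M u \<D>"
    and "weakly_compact M \<D>"
    and "A \<subseteq> L0 M"
    and "consistent M \<D> A"
    and "convex_rvs A"
    and "(\<lambda>_. 0) \<in> A"
    and "W \<in> L1s M \<D>"
    and "F \<in> L1s M \<D>"
  shows "ereal ` I_NBC u A W F = {extE Q F | Q. Q \<in> extreme_measures u \<D> W \<inter> risk_neutral M A}"
proof -
  let ?G = "continuous_rvs M \<D>"
  have rep: "represents M \<D> u" using assms(3) by (simp add: is_determining_set_def)
  then have \<D>: "\<D> \<subseteq> ac_probs M"
    by (auto simp: represents_def)
  have L1s: "L1s M \<D> \<subseteq> ?G" using \<D> by (rule L1s_subset_continuous_rvs)
  then have WF: "W \<in> ?G" "F \<in> ?G" using assms(9,10) by auto
  then have [measurable]: "W \<in> L0 M" "F \<in> L0 M" by (auto simp: continuous_rvs_def)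
  have int: "integrable Q X" if "Q \<in> \<D>" "X \<in> ?G" for Q X
    using representing_density[OF assms(1) \<D> that(1)] that(2)
    by (auto simp: continuous_rvs_def)
  \<comment> \<open>An attained infimum of finite expectations is real, which settles the finiteness
    condition in \<open>extreme_measures\<close>.\<close>
  obtain w where w: "u W = ereal w"
    using utility_attained[OF assms(1) rep assms(4) WF(1)] by blast
  have sub: "(\<lambda>\<omega>. F \<omega> - x) \<in> ?G" for x
    using continuous_rvs_add[OF WF(2) continuous_rvs_const[OF \<D>, of "- x"]] by simp
  have claim: "W' \<in> ?G" if "X \<in> ?G" "W' = (\<lambda>\<omega>. W \<omega> + X \<omega> + h * (F \<omega> - x))" for X W' h x
    unfolding that(2) using that(1) WF sub by (intro continuous_rvs_add continuous_rvs_scale)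
  show ?thesis
  proof (intro equalityI subsetI)
    fix y assume "y \<in> ereal ` I_NBC u A W F"
    then obtain x where x: "x \<in> I_NBC u A W F" and y: "y = ereal x" by auto
    have le: "u (\<lambda>\<omega>. W \<omega> + X \<omega> + h * (F \<omega> - x)) \<le> ereal w" if "X \<in> A" for X h
      using x that by (auto simp: I_NBC_def is_max_def w)
    \<comment> \<open>Minimax needs weakly continuous expectations, so \<open>A\<close> is cut down
      to \<open>?G\<close>; consistency later recovers all of \<open>A\<close>.\<close>
    define C where "C = {\<lambda>\<omega>. W \<omega> + X \<omega> + h * (F \<omega> - x) | X h. X \<in> A \<inter> ?G}"
    have "C \<subseteq> ?G" unfolding C_def using claim by blast
    moreover have "convex_rvs C"
      unfolding convex_rvs_def
    proof (intro ballI allI impI)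
      fix Y Z and t :: real assume "Y \<in> C" "Z \<in> C" and t: "0 \<le> t \<and> t \<le> 1"
      then obtain X h X' h' where *: "X \<in> A \<inter> ?G" "X' \<in> A \<inter> ?G"
        "Y = (\<lambda>\<omega>. W \<omega> + X \<omega> + h * (F \<omega> - x))" "Z = (\<lambda>\<omega>. W \<omega> + X' \<omega> + h' * (F \<omega> - x))"
        unfolding C_def by blast
      have "(\<lambda>\<omega>. (1 - t) * X \<omega> + t * X' \<omega>) \<in> A \<inter> ?G"
        using assms(7) * t by (auto simp: convex_rvs_def intro: continuous_rvs_add continuous_rvs_scale)
      moreover have "(\<lambda>\<omega>. (1 - t) * Y \<omega> + t * Z \<omega>) =
          (\<lambda>\<omega>. W \<omega> + ((1 - t) * X \<omega> + t * X' \<omega>) + ((1 - t) * h + t * h') * (F \<omega> - x))"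
        by (simp add: * algebra_simps)
      ultimately show "(\<lambda>\<omega>. (1 - t) * Y \<omega> + t * Z \<omega>) \<in> C"
        unfolding C_def
        by (intro CollectI exI[of _ "\<lambda>\<omega>. (1 - t) * X \<omega> + t * X' \<omega>"]
            exI[of _ "(1 - t) * h + t * h'"]) simp
    qed
    moreover have "u Y \<le> ereal w" if "Y \<in> C" for Y
      using that le by (auto simp: C_def)
    ultimately have "\<exists>f\<in>densities M \<D>. \<forall>Y\<in>C. (\<integral>\<omega>. Y \<omega> \<partial>density M f) \<le> w"
      by (rule minimax_measure[OF assms(1,3,4)])
    then obtain f where f: "f \<in> densities M \<D>"
      and E_le: "\<And>Y. Y \<in> C \<Longrightarrow> (\<integral>\<omega>. Y \<omega> \<partial>density M f) \<le> w"
      by blast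
    define Q where "Q = density M f"
    have Q: "Q \<in> \<D>" unfolding Q_def by (rule densitiesD(4)[OF f])
    interpret Q: prob_space Q using Q \<D> by (auto simp: ac_probs_def)
    have EQ: "(\<integral>\<omega>. W \<omega> \<partial>Q) + (\<integral>\<omega>. X \<omega> \<partial>Q) + h * ((\<integral>\<omega>. F \<omega> \<partial>Q) - x) \<le> w"
      if X: "X \<in> A \<inter> ?G" for X h
    proof -
      have "(\<lambda>\<omega>. W \<omega> + X \<omega> + h * (F \<omega> - x)) \<in> C"
        using X by (auto simp: C_def)
      from E_le[OF this] show ?thesis
        using int[OF Q] WF X by (simp add: Q_def[symmetric] Q.prob_space)
    qed
    have zero: "(\<lambda>_. 0) \<in> A \<inter> ?G"
      using assms(8) continuous_rvs_const[OF \<D>] by auto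
    \<comment> \<open>Minimax bounds the expectation of \<open>W\<close> from above; membership of
      \<open>Q\<close> in \<open>\<D>\<close> gives the opposite bound.\<close>
    have "u W \<le> extE Q W" using represents_le[OF rep Q] by simp
    then have "w \<le> (\<integral>\<omega>. W \<omega> \<partial>Q)"
      using int[OF Q WF(1)] by (simp add: w extE_integrable)
    with EQ[OF zero, of 0] have EW: "(\<integral>\<omega>. W \<omega> \<partial>Q) = w" by simp
    have EF: "(\<integral>\<omega>. F \<omega> \<partial>Q) = x"
      using EQ[OF zero, of 1] EQ[OF zero, of "-1"] by (simp add: EW)
    have EX: "extE Q X \<le> 0" if "X \<in> A \<inter> ?G" for X
      using EQ[OF that, of 0] that int[OF Q] by (simp add: EW extE_integrable)
    obtain A' where A': "A' \<subseteq> A \<inter> L1s M \<D>"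
      "\<D> \<inter> risk_neutral M A = \<D> \<inter> risk_neutral M A'"
      using assms(6) by (auto simp: consistent_def)
    \<comment> \<open>\<open>A'\<close> lies in \<open>L1s M \<D>\<close>, hence in
      \<open>?G\<close>, where the inequality is available.\<close>
    then have "extE Q X \<le> 0" if "X \<in> A'" for X
      using EX that L1s by blast
    then have "Q \<in> risk_neutral M A'"
      using Q \<D> by (auto simp: risk_neutral_def)
    with A'(2) Q have "Q \<in> risk_neutral M A" by blast
    moreover have "Q \<in> extreme_measures u \<D> W"
      using Q EW int[OF Q WF(1)] by (simp add: extreme_measures_def w extE_integrable)
    moreover have "y = extE Q F"
      using EF int[OF Q WF(2)] by (simp add: y extE_integrable)
    ultimately show "y \<in> {extE Q F | Q. Q \<in> extreme_measures u \<D> W \<inter> risk_neutral M A}"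
      by blast
  next
    fix y assume "y \<in> {extE Q F | Q. Q \<in> extreme_measures u \<D> W \<inter> risk_neutral M A}"
    then obtain Q where Q: "Q \<in> \<D>" "extE Q W = u W" and y: "y = extE Q F"
      and R: "\<And>X. X \<in> A \<Longrightarrow> extE Q X \<le> 0"
      by (auto simp: extreme_measures_def risk_neutral_def)
    have ac: "prob_space Q" "sets Q = sets M" using Q(1) \<D> by (auto simp: ac_probs_def)
    interpret Q: prob_space Q by fact
    have [measurable_cong]: "sets Q = sets M" by fact
    \<comment> \<open>With this price \<open>h * (F - x)\<close> has mean zero under
      \<open>Q\<close>, so neither it nor any \<open>X\<close> in \<open>A\<close> can lift the
      expectation under \<open>Q\<close> above \<open>u W\<close>.\<close>
    define x where "x = (\<integral>\<omega>. F \<omega> \<partial>Q)"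
    have EW: "(\<integral>\<omega>. W \<omega> \<partial>Q) = w"
      using Q(2) int[OF Q(1) WF(1)] by (simp add: w extE_integrable)
    have "u (\<lambda>\<omega>. W \<omega> + X \<omega> + h * (F \<omega> - x)) \<le> u W" if X: "X \<in> A" for X h
    proof -
      have [measurable]: "X \<in> L0 M" using X assms(5) by blast
      \<comment> \<open>The integrable part is grouped apart from \<open>X\<close>, which may be
        non-integrable under \<open>Q\<close>.\<close>
      let ?Y = "\<lambda>\<omega>. W \<omega> + h * (F \<omega> - x)"
      have Y: "integrable Q ?Y" using int[OF Q(1)] WF by simp
      have "u (\<lambda>\<omega>. W \<omega> + X \<omega> + h * (F \<omega> - x)) \<le> extE Q (\<lambda>\<omega>. W \<omega> + X \<omega> + h * (F \<omega> - x))"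
        by (intro represents_le[OF rep Q(1)]) measurable
      also have "\<dots> = extE Q (\<lambda>\<omega>. ?Y \<omega> + X \<omega>)"
        by (simp add: algebra_simps)
      also have "\<dots> \<le> ereal (\<integral>\<omega>. ?Y \<omega> \<partial>Q)"
        using Y R[OF X] by (intro extE_add_le) measurable
      also have "(\<integral>\<omega>. ?Y \<omega> \<partial>Q) = w"
        using int[OF Q(1)] WF EW by (simp add: x_def Q.prob_space)
      finally show ?thesis by (simp add: w)
    qed
    moreover have "\<exists>X h. u W = u (\<lambda>\<omega>. W \<omega> + X \<omega> + h * (F \<omega> - x)) \<and> X \<in> A"
      using assms(8) by (intro exI[of _ "\<lambda>_. 0"] exI[of _ 0]) simp
    ultimately have "x \<in> I_NBC u A W F"
      by (auto simp: I_NBC_def is_max_def)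
    moreover have "y = ereal x"
      using int[OF Q(1) WF(2)] by (simp add: y x_def extE_integrable)
    ultimately show "y \<in> ereal ` I_NBC u A W F" by blast
  qed
qed

end
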